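(* Let $f,g:\mathbb{R}\to\mathbb{R}$ be continuously differentiable functions. Assume that $p\in\mathbb{R}$ is an isolated zero of $f$ such that $f'(p)\neq 0$, and that $g$ has an isolated zero at the origin (that is, $g(0)=0$ and $g$ does not vanish at any other point of some neighborhood of $0$). If $f''$ exists and is continuous, then there is a neighborhood $V$ of $p$ such that, for every $x_0\in V$, the sequence $(x_n)_{n\ge 0}$ produced by the $g$-Steffensen iteration $$x_{n+1}=x_n-\frac{g(f(x_n))\, f(x_n)}{f\bigl(x_n+g(f(x_n))\bigr)-f(x_n)},\qquad n\ge 0,$$ (with the convention that $x_{n+1}=p$ if $x_n=p$) converges to $p$.
   Context: The $g$-Steffensen method for solving $f(x)=0$ is the iteration displayed in the claim; the choice $g(x)=x$ gives the classical Steffensen method. At $x_n=p$ the displayed quotient has the form $0/0$; the convention is that the iteration map fixes $p$, i.e. $x_{n+1}=p$ whenever $x_n=p$. Equivalently, the iteration map is $\phi(x)=x-f(x)/\rho(x)$ with $\rho(x)=\frac{f(x+g(f(x)))-f(x)}{g(f(x))}$ for $x\neq p$ and $\rho(p)=f'(p)$. Part of the assertion is that the sequence is well defined for $x_0\in V$. *)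

theory Defs
  imports "HOL-Analysis.Analysis"
begin

definition steffensen_denom :: "(real \<Rightarrow> real) \<Rightarrow> (real \<Rightarrow> real) \<Rightarrow> real \<Rightarrow> real" where
  "steffensen_denom f g x = f (x + g (f x)) - f x"

text \<open>At \<open>x = p\<close> the quotient has the form 0/0; by convention the iteration map fixes \<open>p\<close>.\<close>

definition steffensen_step ::
    "(real \<Rightarrow> real) \<Rightarrow> (real \<Rightarrow> real) \<Rightarrow> real \<Rightarrow> real \<Rightarrow> real" where
  "steffensen_step f g p x =
     (if x = p then p else x - g (f x) * f x / steffensen_denom f g x)"

primrec steffensen_seq ::
    "(real \<Rightarrow> real) \<Rightarrow> (real \<Rightarrow> real) \<Rightarrow> real \<Rightarrow> real \<Rightarrow> nat \<Rightarrow> real" where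
  "steffensen_seq f g p x0 0 = x0"
| "steffensen_seq f g p x0 (Suc n) = steffensen_step f g p (steffensen_seq f g p x0 n)"

text \<open>Division in HOL is total, with \<open>a / 0 = 0\<close>, so \<open>steffensen_seq\<close> always has a value. It is
  the sequence meant in the mathematics only if no step divides by zero away from \<open>p\<close>. A nonzero
  denominator also gives \<open>g (f x) \<noteq> 0\<close>, so the difference quotient
  \<open>(f (x + g (f x)) - f x) / g (f x)\<close> is then defined and nonzero too.\<close>

definition steffensen_well_defined ::
    "(real \<Rightarrow> real) \<Rightarrow> (real \<Rightarrow> real) \<Rightarrow> real \<Rightarrow> real \<Rightarrow> bool" where
  "steffensen_well_defined f g p x0 \<longleftrightarrow>
     (\<forall>n. steffensen_seq f g p x0 n \<noteq> p \<longrightarrow>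
        steffensen_denom f g (steffensen_seq f g p x0 n) \<noteq> 0)"

end

theory Submission
  imports Defs
begin

text \<open>
  Local convergence holds because one step contracts the distance to \<open>p\<close>. By the mean value
  theorem, both differences of values of \<open>f\<close> that enter a step are slopes times increments: with
  \<open>h = g (f x)\<close>, \<open>f x = f x - f p = (x - p) * f' s\<close> and \<open>f (x + h) - f x = h * f' t\<close>, where \<open>s\<close>
  and \<open>t\<close> lie near \<open>p\<close>. As soon as \<open>h \<noteq> 0\<close> it cancels, and the new error is
  \<open>(x - p) * (1 - f' s / f' t)\<close>. Since \<open>f'\<close> is continuous at \<open>p\<close> with \<open>f' p \<noteq> 0\<close>, the two slopes
  have a ratio close to \<open>1\<close>, so the error shrinks by a fixed factor (\<open>2 / 3\<close> below) throughout a
  ball around \<open>p\<close>. That \<open>h \<noteq> 0\<close> for \<open>x \<noteq> p\<close> in this ball is what the two isolated zeros give: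
  \<open>f x\<close> is nonzero and close to \<open>0\<close>, so \<open>g\<close> does not vanish there. The nonzero \<open>h\<close> and the nonzero
  slope \<open>f' t\<close> also keep the denominator away from zero, and the iterates stay in the ball by
  contraction, so the sequence is well defined and converges geometrically.
\<close>

lemma mean_value_in_ball:
  fixes f f' :: "real \<Rightarrow> real"
  assumes deriv: "\<And>x. (f has_real_derivative f' x) (at x)"
    and "u \<in> ball p d" "v \<in> ball p d"
  obtains t where "t \<in> ball p d" "f v - f u = (v - u) * f' t"
proof -
  have "p \<in> ball p d"
    using assms(2) by (auto intro: le_less_trans[OF zero_le_dist])
  consider "u = v" | "u < v" | "v < u" by linarith
  then show ?thesis
  proof cases
    case 1
    then show ?thesis using that[OF \<open>p \<in> ball p d\<close>] by simp
  next
    case 2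
    obtain t where "u < t" "t < v" "f v - f u = (v - u) * f' t"
      using MVT2[OF 2, of f f'] deriv by blast
    moreover have "t \<in> ball p d"
      using assms(2,3) \<open>u < t\<close> \<open>t < v\<close> by (auto simp: dist_real_def abs_if split: if_splits)
    ultimately show ?thesis using that by blast
  next
    case 3
    obtain t where "v < t" "t < u" "f u - f v = (u - v) * f' t"
      using MVT2[OF 3, of f f'] deriv by blast
    moreover have "t \<in> ball p d"
      using assms(2,3) \<open>v < t\<close> \<open>t < u\<close> by (auto simp: dist_real_def abs_if split: if_splits)
    ultimately show ?thesis
      using that[of t] by (simp add: algebra_simps)
  qed
qed

text \<open>
  Two slopes within \<open>\<bar>c\<bar> / 4\<close> of \<open>c\<close> differ by at most \<open>\<bar>c\<bar> / 2\<close>, while each has absolute value at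
  least \<open>3 * \<bar>c\<bar> / 4\<close>; the quotient of these bounds is the factor \<open>2 / 3\<close>.
\<close>

lemma slope_ratio_near_one:
  fixes a b c :: real
  assumes "c \<noteq> 0" "\<bar>a - c\<bar> \<le> \<bar>c\<bar> / 4" "\<bar>b - c\<bar> \<le> \<bar>c\<bar> / 4"
  shows "b \<noteq> 0" "\<bar>1 - a / b\<bar> \<le> 2 / 3"
proof -
  have b: "\<bar>b\<bar> \<ge> 3 * \<bar>c\<bar> / 4" and ab: "\<bar>b - a\<bar> \<le> \<bar>c\<bar> / 2"
    using assms(2,3) by linarith+
  show "b \<noteq> 0" using b assms(1) by auto
  then have "\<bar>1 - a / b\<bar> = \<bar>b - a\<bar> / \<bar>b\<bar>"
    by (simp add: diff_divide_distrib flip: abs_divide)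
  also have "\<dots> \<le> 2 / 3"
    using b ab \<open>b \<noteq> 0\<close> by (simp add: divide_simps)
  finally show "\<bar>1 - a / b\<bar> \<le> 2 / 3" .
qed

text \<open>
  The step offset \<open>g (f x)\<close> occurs in the numerator and, through the mean value theorem, as a factor
  of the denominator. Its size therefore does not matter, as long as \<open>x + g (f x)\<close> stays where the
  slopes are controlled and the offset can be cancelled.
\<close>

lemma steffensen_step_contraction:
  fixes f f' g :: "real \<Rightarrow> real"
  assumes deriv: "\<And>x. (f has_real_derivative f' x) (at x)"
    and "f p = 0" "c \<noteq> 0"
    and slope: "\<And>t. t \<in> ball p d \<Longrightarrow> \<bar>f' t - c\<bar> \<le> \<bar>c\<bar> / 4"
    and "x \<noteq> p" and x: "x \<in> ball p d" and xh: "x + g (f x) \<in> ball p d"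
    and h: "g (f x) \<noteq> 0"
  shows "steffensen_denom f g x \<noteq> 0"
    and "\<bar>steffensen_step f g p x - p\<bar> \<le> 2 / 3 * \<bar>x - p\<bar>"
proof -
  have p: "p \<in> ball p d"
    using x by (auto intro: le_less_trans[OF zero_le_dist])
  obtain s where s: "s \<in> ball p d" "f x - f p = (x - p) * f' s"
    using mean_value_in_ball[OF deriv p x] by blast
  obtain t where t: "t \<in> ball p d" "f (x + g (f x)) - f x = g (f x) * f' t"
    using mean_value_in_ball[OF deriv x xh] by (metis add_diff_cancel_left')
  note ratio = slope_ratio_near_one[OF \<open>c \<noteq> 0\<close> slope[OF s(1)] slope[OF t(1)]]
  show "steffensen_denom f g x \<noteq> 0"
    using t(2) h ratio(1) by (simp add: steffensen_denom_def)
  have "steffensen_step f g p x - p = (x - p) * (1 - f' s / f' t)"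
    using \<open>x \<noteq> p\<close> s(2) t(2) h ratio(1) \<open>f p = 0\<close>
    by (simp add: steffensen_step_def steffensen_denom_def field_simps)
  then show "\<bar>steffensen_step f g p x - p\<bar> \<le> 2 / 3 * \<bar>x - p\<bar>"
    using mult_left_mono[OF ratio(2), of "\<bar>x - p\<bar>"] by (simp add: abs_mult mult.commute)
qed

lemma steffensen_seq_convergence:
  assumes "0 \<le> q" "q < 1"
    and denom: "\<And>x. x \<in> ball p r \<Longrightarrow> x \<noteq> p \<Longrightarrow> steffensen_denom f g x \<noteq> 0"
    and contr: "\<And>x. x \<in> ball p r \<Longrightarrow> x \<noteq> p \<Longrightarrow> \<bar>steffensen_step f g p x - p\<bar> \<le> q * \<bar>x - p\<bar>"
    and x0: "x0 \<in> ball p r"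
  shows "steffensen_well_defined f g p x0" "steffensen_seq f g p x0 \<longlonglongrightarrow> p"
proof -
  let ?x = "steffensen_seq f g p x0"
  have ball: "x \<in> ball p r" if "\<bar>x - p\<bar> \<le> q ^ n * \<bar>x0 - p\<bar>" for x n
  proof -
    have "q ^ n * \<bar>x0 - p\<bar> \<le> \<bar>x0 - p\<bar>"
      using assms(1,2) by (simp add: mult_left_le_one_le power_le_one)
    then show ?thesis
      using that x0 by (simp add: dist_real_def abs_minus_commute)
  qed
  have bound: "\<bar>?x n - p\<bar> \<le> q ^ n * \<bar>x0 - p\<bar>" for n
  proof (induction n)
    case 0
    then show ?case by simp
  next
    case (Suc n)
    have "\<bar>?x (Suc n) - p\<bar> \<le> q * \<bar>?x n - p\<bar>"
      using contr[OF ball[OF Suc]] by (cases "?x n = p") (auto simp: steffensen_step_def)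
    also have "\<dots> \<le> q * (q ^ n * \<bar>x0 - p\<bar>)"
      using Suc \<open>0 \<le> q\<close> by (rule mult_left_mono)
    finally show ?case by (simp add: mult.assoc)
  qed
  show "steffensen_well_defined f g p x0"
    using denom ball[OF bound] by (simp add: steffensen_well_defined_def)
  have "(\<lambda>n. q ^ n * \<bar>x0 - p\<bar>) \<longlonglongrightarrow> 0"
    using LIMSEQ_power_zero[of q] assms(1,2) by (intro tendsto_mult_left_zero) simp
  then have "(\<lambda>n. ?x n - p) \<longlonglongrightarrow> 0"
    by (rule Lim_null_comparison[rotated]) (simp add: bound)
  then show "?x \<longlonglongrightarrow> p"
    by (simp add: LIM_zero_iff)
qed

lemma C1_differentiable_on_UNIV_real:
  fixes f :: "real \<Rightarrow> real"
  assumes "f C1_differentiable_on UNIV"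
  shows "(f has_real_derivative deriv f x) (at x)" "isCont f x" "isCont (deriv f) x"
proof -
  obtain D where D: "\<And>x. (f has_real_derivative D x) (at x)" "continuous_on UNIV D"
    using assms unfolding C1_differentiable_on_def has_real_derivative_iff_has_vector_derivative
    by auto
  then have "deriv f = D"
    by (auto intro: DERIV_imp_deriv)
  with D show "(f has_real_derivative deriv f x) (at x)" "isCont f x" "isCont (deriv f) x"
    by (auto intro: DERIV_isCont simp: continuous_on_eq_continuous_at)
qed

lemma isolated_zero_eventually_nonzero:
  assumes "p isolated_in {x. f x = 0}"
  shows "f p = 0" "eventually (\<lambda>x. x \<noteq> p \<longrightarrow> f x \<noteq> 0) (nhds p)"
proof -
  show "f p = 0"
    using assms by (simp add: isolated_in_def)
  obtain T where "open T" "T \<inter> {x. f x = 0} = {p}"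
    using assms by (auto simp: isolated_in_def)
  then show "eventually (\<lambda>x. x \<noteq> p \<longrightarrow> f x \<noteq> 0) (nhds p)"
    unfolding eventually_nhds by blast
qed

theorem theorem3p1:
  fixes f g :: "real \<Rightarrow> real" and p :: real
  assumes "f C1_differentiable_on UNIV"
    and "g C1_differentiable_on UNIV"
    and "p isolated_in {x. f x = 0}"
    and "deriv f p \<noteq> 0"
    and "0 isolated_in {x. g x = 0}"
    and "deriv f C1_differentiable_on UNIV"
  shows "\<exists>V. open V \<and> p \<in> V \<and>
    (\<forall>x0\<in>V. steffensen_well_defined f g p x0 \<and> steffensen_seq f g p x0 \<longlonglongrightarrow> p)"
proof -
  let ?c = "deriv f p"
  note f = C1_differentiable_on_UNIV_real[OF assms(1)]
  note g = C1_differentiable_on_UNIV_real[OF assms(2)]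
  note fp = isolated_zero_eventually_nonzero[OF assms(3)]
  note g0 = isolated_zero_eventually_nonzero[OF assms(5)]
  have f_lim: "filterlim f (nhds 0) (nhds p)"
    using f(2)[of p] fp(1) unfolding isCont_def tendsto_at_iff_tendsto_nhds by simp
  have shift_lim: "filterlim (\<lambda>x. x + g (f x)) (nhds p) (nhds p)"
  proof -
    have "isCont (\<lambda>x. x + g (f x)) p"
      using f(2) g(2) by (intro continuous_intros isCont_o2[of p f g])
    then show ?thesis
      using tendsto_at_iff_tendsto_nhds[of "\<lambda>x. x + g (f x)" p] by (simp add: isCont_def fp(1) g0(1))
  qed
  obtain d where "d > 0" and slope: "\<And>t. t \<in> ball p d \<Longrightarrow> \<bar>deriv f t - ?c\<bar> \<le> \<bar>?c\<bar> / 4"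
  proof -
    have "\<bar>?c\<bar> / 4 > 0" using assms(4) by simp
    then obtain d where "d > 0" "\<forall>t. dist t p < d \<longrightarrow> dist (deriv f t) ?c < \<bar>?c\<bar> / 4"
      using f(3)[of p] unfolding continuous_at_eps_delta by (metis dist_real_def real_norm_def)
    then show ?thesis
      using that[of d] by (force simp: dist_commute dist_real_def)
  qed
  have "eventually (\<lambda>x. x \<in> ball p d) (nhds p)"
    using \<open>d > 0\<close> by (intro eventually_nhds_in_open) auto
  moreover from this have "eventually (\<lambda>x. x + g (f x) \<in> ball p d) (nhds p)"
    using shift_lim by (rule eventually_compose_filterlim)
  moreover have "eventually (\<lambda>x. f x \<noteq> 0 \<longrightarrow> g (f x) \<noteq> 0) (nhds p)"
    using g0(2) f_lim by (rule eventually_compose_filterlim)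
  ultimately have "eventually (\<lambda>x. x \<in> ball p d \<and> x + g (f x) \<in> ball p d
      \<and> (x \<noteq> p \<longrightarrow> g (f x) \<noteq> 0)) (nhds p)"
    using fp(2) by eventually_elim auto
  then obtain r where "r > 0" and r: "\<And>x. x \<in> ball p r \<Longrightarrow>
      x \<in> ball p d \<and> x + g (f x) \<in> ball p d \<and> (x \<noteq> p \<longrightarrow> g (f x) \<noteq> 0)"
    unfolding eventually_nhds_metric by (metis dist_commute mem_ball)
  have "steffensen_denom f g x \<noteq> 0" "\<bar>steffensen_step f g p x - p\<bar> \<le> 2 / 3 * \<bar>x - p\<bar>"
    if "x \<in> ball p r" "x \<noteq> p" for x
    using steffensen_step_contraction[OF f(1) fp(1) assms(4) slope \<open>x \<noteq> p\<close>] r[OF that(1)] that(2)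
    by blast+
  then have "\<forall>x0\<in>ball p r. steffensen_well_defined f g p x0 \<and> steffensen_seq f g p x0 \<longlonglongrightarrow> p"
    using steffensen_seq_convergence[of "2 / 3" p r f g] by simp
  then show ?thesis
    using \<open>r > 0\<close> by (intro exI[of _ "ball p r"]) auto
qed

end
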